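(* Let $a \in (0,1)$ and define $$\mathcal{N}(a) = \frac{20800}{a^7(1-a)^4}.$$ Let $n$ be an integer with $n \geq \mathcal{N}(a)$, and let $P(z) = (z-a)\prod_{j=1}^{n-1}(z-z_j)$ be a polynomial with $z_1,\dots,z_{n-1}\in\mathbb{C}$ and $|z_j|\leq 1$ for all $j = 1, \ldots , n-1$. Then the closed disk $\{z\in\mathbb{C} : |z-a|\leq 1\}$ contains a critical point of $P$ (i.e. a zero of $P'$). *)

theory Defs
  imports "HOL-Analysis.Analysis" "HOL-Computational_Algebra.Polynomial"
begin

definition sendov_N :: "real \<Rightarrow> real" where
  "sendov_N a = 20800 / (a ^ 7 * (1 - a) ^ 4)"

end

theory Submission
  imports Defs "HOL-Computational_Algebra.Fundamental_Theorem_Algebra"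
begin

text \<open>
  Let \<open>m = n - 1\<close> and suppose that every critical point lies in the lune
  \<open>|s| \<le> 1 \<le> |s - a|\<close> (Gauss--Lucas). At points \<open>x\<close> of the open segment from \<open>0\<close> to \<open>a\<close>, \<open>|x - s|\<close> is
  smaller than \<open>|a - s|\<close> by a fixed factor, so \<open>P'\<close> is exponentially smaller there than at
  \<open>a\<close>. Since \<open>P(a) = 0\<close>, the polynomial \<open>P\<close> is therefore nearly constant to the left of \<open>a\<close>, of
  modulus about \<open>|P'(a)| / m \<ge> 1\<close>. Evaluating it very close to \<open>0\<close> shows that the zeros have
  modulus close to \<open>1\<close> on average, and evaluating \<open>P'/P\<close> at a point \<open>w\<close> in \<open>(a/2, a)\<close> shows that the
  average of \<open>1 / (z\<^sub>j - w)\<close> is small. On the unit circle \<open>1 / (z - w)\<close> is the conjugate of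
  \<open>g(z) = z / (1 - w z)\<close>, so the average of \<open>g\<close> over the zeros is small. Up to \<open>O(1/m)\<close> it is also
  the average of \<open>g\<close> over the critical points, because \<open>g\<close> is affine in \<open>1 / (1/w - z)\<close> and the
  logarithmic derivatives of \<open>P\<close> and \<open>P'\<close> at \<open>1/w\<close> differ by \<open>O(1)\<close>. But \<open>Re g\<close> is negative and
  bounded away from \<open>0\<close> on the lune.
\<close>

section \<open>Logarithmic derivatives outside the unit disk\<close>

text \<open>With \<open>s = |v|\<close>, the map \<open>1 / (1 - v)\<close> sends the circle of
  radius \<open>s\<close> about 0 to the circle whose diameter is the real segment from
  \<open>1 / (1 + s)\<close> to \<open>1 / (1 - s)\<close>.\<close>

lemma Re_inverse_one_minus_ge:
  fixes v :: complex
  assumes "cmod v < 1"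
  shows "1 / (1 + cmod v) \<le> Re (1 / (1 - v))"
proof -
  let ?s = "cmod v"
  have "\<bar>Re v\<bar> \<le> ?s" by (rule abs_Re_le_cmod)
  then have "0 \<le> (?s + Re v) * (1 - ?s)"
    using assms by (intro mult_nonneg_nonneg) auto
  moreover have s2: "?s ^ 2 = Re v ^ 2 + Im v ^ 2" by (rule cmod_power2)
  ultimately have le: "(1 - Re v)\<^sup>2 + (Im v)\<^sup>2 \<le> (1 - Re v) * (1 + ?s)"
    by (simp add: algebra_simps power2_eq_square)
  have "v \<noteq> 1" using assms by auto
  then have "0 < (1 - Re v)\<^sup>2 + (Im v)\<^sup>2"
    by (metis (no_types) complex_eq_iff diff_eq_eq eq_iff_diff_eq_0 one_complex.sel sum_power2_gt_zero_iff)
  moreover have "Re (1 / (1 - v)) = (1 - Re v) / ((1 - Re v)\<^sup>2 + (Im v)\<^sup>2)"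
    by (simp add: Re_divide)
  moreover have "0 < 1 + ?s" by (simp add: add_pos_nonneg)
  ultimately show ?thesis using le by (simp add: pos_divide_le_eq pos_le_divide_eq)
qed

text \<open>After multiplication by \<open>u\<close> every term has real part at least
  \<open>|u| / (|u| + 1)\<close>, so the terms cannot cancel.\<close>

lemma cmod_sum_inverse_ge:
  fixes r :: "'i \<Rightarrow> complex"
  assumes "\<And>i. i \<in> I \<Longrightarrow> cmod (r i) \<le> 1" and "1 < cmod u"
  shows "card I / (cmod u + 1) \<le> cmod (\<Sum>i\<in>I. 1 / (u - r i))"
proof -
  have u: "0 < cmod u" "u \<noteq> 0" using assms(2) by auto
  have "cmod u / (cmod u + 1) \<le> Re (u * (1 / (u - r i)))" if "i \<in> I" for i
  proof -
    have "cmod (r i / u) < 1" using assms(1)[OF that] assms(2) u by (simp add: norm_divide)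
    then have "1 / (1 + cmod (r i / u)) \<le> Re (1 / (1 - r i / u))"
      by (rule Re_inverse_one_minus_ge)
    moreover have "1 / (1 - r i / u) = u * (1 / (u - r i))"
      using u by (simp add: field_simps)
    moreover have "cmod u / (cmod u + 1) \<le> 1 / (1 + cmod (r i / u))"
      using assms(1)[OF that] u
      by (simp add: norm_divide field_simps add_pos_nonneg pos_add_strict)
    ultimately show ?thesis by simp
  qed
  then have "(\<Sum>i\<in>I. cmod u / (cmod u + 1)) \<le> (\<Sum>i\<in>I. Re (u * (1 / (u - r i))))"
    by (rule sum_mono)
  also have "\<dots> = Re (u * (\<Sum>i\<in>I. 1 / (u - r i)))"
    by (simp add: sum_distrib_left)
  also have "\<dots> \<le> cmod u * cmod (\<Sum>i\<in>I. 1 / (u - r i))"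
    by (metis complex_Re_le_cmod norm_mult)
  finally have "cmod u * (card I / (cmod u + 1)) \<le> cmod u * cmod (\<Sum>i\<in>I. 1 / (u - r i))"
    by (simp add: mult.commute)
  then show ?thesis using u(1) by (rule mult_left_le_imp_le)
qed

lemma has_field_derivative_prod_roots:
  fixes r :: "'i \<Rightarrow> 'a::real_normed_field"
  assumes "\<And>i. i \<in> I \<Longrightarrow> x \<noteq> r i"
  shows "((\<lambda>x. \<Prod>i\<in>I. (x - r i)) has_field_derivative
          (\<Prod>i\<in>I. (x - r i)) * (\<Sum>i\<in>I. 1 / (x - r i))) (at x)"
  by (rule has_field_derivative_prod'[where f' = "\<lambda>_. 1", simplified])
     (use assms in \<open>auto intro!: derivative_eq_intros\<close>)

lemma has_field_derivative_sum_inverse: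
  fixes r :: "'i \<Rightarrow> 'a::real_normed_field"
  assumes "\<And>i. i \<in> I \<Longrightarrow> x \<noteq> r i"
  shows "((\<lambda>x. \<Sum>i\<in>I. 1 / (x - r i)) has_field_derivative
          - (\<Sum>i\<in>I. 1 / (x - r i)\<^sup>2)) (at x)"
proof -
  have "((\<lambda>x. \<Sum>i\<in>I. 1 / (x - r i)) has_field_derivative
          (\<Sum>i\<in>I. - (1 / (x - r i)\<^sup>2))) (at x)"
    using assms
    by (intro DERIV_sum) (auto intro!: derivative_eq_intros simp: power2_eq_square)
  then show ?thesis by (simp add: sum_negf)
qed

lemma Gauss_Lucas_unit_disk:
  fixes r :: "'i \<Rightarrow> complex"
  assumes "finite I" "I \<noteq> {}" "\<And>i. i \<in> I \<Longrightarrow> cmod (r i) \<le> 1"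
    and "((\<lambda>x. \<Prod>i\<in>I. (x - r i)) has_field_derivative 0) (at s)"
  shows "cmod s \<le> 1"
proof (rule ccontr)
  assume "\<not> cmod s \<le> 1"
  then have s: "1 < cmod s" by simp
  then have ne: "s \<noteq> r i" if "i \<in> I" for i using assms(3)[OF that] by auto
  then have "(\<Prod>i\<in>I. (s - r i)) * (\<Sum>i\<in>I. 1 / (s - r i)) = 0"
    using DERIV_unique[OF has_field_derivative_prod_roots assms(4)] by blast
  then have "(\<Sum>i\<in>I. 1 / (s - r i)) = 0"
    using ne assms(1) by simp
  moreover have "0 < card I / (cmod s + 1)"
    using assms(1,2) s by (intro divide_pos_pos) (auto simp: card_gt_0_iff)
  ultimately show False using cmod_sum_inverse_ge[of I r s] assms(3) s by simp
qed

text \<open>Let \<open>F = p' / p\<close> and \<open>H = q' / q\<close> for \<open>q = p'\<close>.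
  Differentiating \<open>q = p F\<close> gives \<open>F (H - F) = - G\<close>. Both the upper bound
  on \<open>|G|\<close> and the lower bound on \<open>|F|\<close> are proportional to
  \<open>card I\<close>, which therefore cancels: the difference stays bounded as the degree
  grows.\<close>

lemma log_derivative_diff_le:
  fixes r :: "'i \<Rightarrow> complex" and s :: "'j \<Rightarrow> complex"
  assumes I: "finite I" "I \<noteq> {}"
    and r: "\<And>i. i \<in> I \<Longrightarrow> cmod (r i) \<le> 1" and s: "\<And>j. j \<in> J \<Longrightarrow> cmod (s j) \<le> 1"
    and der: "\<And>x. ((\<lambda>x. \<Prod>i\<in>I. (x - r i)) has_field_derivative c * (\<Prod>j\<in>J. (x - s j))) (at x)"
    and u: "1 < cmod u"
  shows "cmod ((\<Sum>j\<in>J. 1 / (u - s j)) - (\<Sum>i\<in>I. 1 / (u - r i)))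
           \<le> (cmod u + 1) / (cmod u - 1)\<^sup>2"
proof -
  define p where "p x = (\<Prod>i\<in>I. (x - r i))" for x
  define q where "q x = c * (\<Prod>j\<in>J. (x - s j))" for x
  define F where "F x = (\<Sum>i\<in>I. 1 / (x - r i))" for x
  define G where "G x = (\<Sum>i\<in>I. 1 / (x - r i)\<^sup>2)" for x
  define H where "H = (\<Sum>j\<in>J. 1 / (u - s j))"
  have ner: "x \<noteq> r i" if "1 < cmod x" "i \<in> I" for x i using r[OF that(2)] that(1) by auto
  have nes: "u \<noteq> s j" if "j \<in> J" for j using s[OF that] u by auto
  have dp: "(p has_field_derivative q x) (at x)" for x
    using der unfolding p_def q_def .
  have q: "q x = p x * F x" if "1 < cmod x" for x
    using DERIV_unique[OF dp[of x], of "p x * F x"] has_field_derivative_prod_roots[of I x r] ner[OF that]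
    by (auto simp: p_def[abs_def] F_def)
  have "(F has_field_derivative - G u) (at u)"
    unfolding F_def[abs_def] G_def using ner[OF u] by (intro has_field_derivative_sum_inverse) auto
  then have 1: "((\<lambda>x. p x * F x) has_field_derivative q u * F u - p u * G u) (at u)"
    by (auto intro!: derivative_eq_intros dp)
  \<comment> \<open>\<open>q = p F\<close> is available only outside the disk; openness allows it to
    be differentiated at \<open>u\<close>.\<close>
  have "open {x::complex. 1 < cmod x}" by (intro open_Collect_less continuous_intros)
  then have 2: "(q has_field_derivative q u * F u - p u * G u) (at u)"
    using has_field_derivative_transform_within_open[OF 1, of "{x. 1 < cmod x}" q] q u by simp
  have "(q has_field_derivative q u * H) (at u)"
    unfolding q_def[abs_def] H_def mult.assoc
    by (intro DERIV_cmult has_field_derivative_prod_roots) (use nes in auto)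
  from DERIV_unique[OF this 2] have "p u * (F u * H - F u ^ 2 + G u) = 0"
    using q[OF u] by (simp add: algebra_simps power2_eq_square)
  moreover have "p u \<noteq> 0" using ner[OF u] I by (auto simp: p_def)
  ultimately have "F u * H - F u ^ 2 + G u = 0" by simp
  then have eq: "F u * (H - F u) = - G u"
    by (simp add: algebra_simps power2_eq_square eq_neg_iff_add_eq_0)
  have "cmod (G u) \<le> (\<Sum>i\<in>I. 1 / (cmod u - 1)\<^sup>2)"
    unfolding G_def
  proof (rule sum_norm_le)
    fix i assume "i \<in> I"
    then have "cmod u - 1 \<le> cmod (u - r i)"
      using r norm_triangle_ineq2[of u "r i"] by fastforce
    then show "cmod (1 / (u - r i)\<^sup>2) \<le> 1 / (cmod u - 1)\<^sup>2"
      using u by (simp add: norm_divide norm_power frac_le power_mono)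
  qed
  then have G: "cmod (G u) \<le> card I / (cmod u - 1)\<^sup>2" by simp
  have "card I / (cmod u + 1) \<le> cmod (F u)"
    unfolding F_def by (rule cmod_sum_inverse_ge[OF r u])
  then have "card I / (cmod u + 1) * cmod (H - F u) \<le> cmod (F u) * cmod (H - F u)"
    by (rule mult_right_mono) simp
  also have "\<dots> = cmod (G u)" using eq by (metis norm_minus_cancel norm_mult)
  also note G
  finally have "card I * (cmod (H - F u) / (cmod u + 1)) \<le> card I * (1 / (cmod u - 1)\<^sup>2)" by simp
  moreover have "0 < real (card I)" using I by (simp add: card_gt_0_iff)
  ultimately have "cmod (H - F u) / (cmod u + 1) \<le> 1 / (cmod u - 1)\<^sup>2"
    by (rule mult_left_le_imp_le)
  moreover have "0 < cmod u + 1" using u by simp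
  ultimately show ?thesis unfolding H_def F_def by (simp add: pos_divide_le_eq)
qed

section \<open>Geometry of the lune\<close>

lemma power2_cmod_of_real_diff:
  "(cmod (of_real t - s))\<^sup>2 = t\<^sup>2 - 2 * t * Re s + (cmod s)\<^sup>2"
  unfolding cmod_power2 by (simp add: power2_eq_square algebra_simps)

text \<open>The point \<open>s\<close> is at least as close to 0 as to \<open>a\<close>, so it lies
  on the left of the perpendicular bisector of the segment joining them.\<close>

lemma lune_Re_le:
  assumes "0 < a" "cmod s \<le> 1" "1 \<le> cmod (of_real a - s)"
  shows "Re s \<le> a / 2"
proof -
  have "1 \<le> (cmod (of_real a - s))\<^sup>2" "(cmod s)\<^sup>2 \<le> 1"
    using assms by (auto simp: abs_square_le_1 one_le_power)
  then have "0 \<le> a * (a - 2 * Re s)"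
    unfolding power2_cmod_of_real_diff by (simp add: algebra_simps power2_eq_square)
  then show ?thesis using assms(1) by (simp add: zero_le_mult_iff)
qed

lemma lune_cmod_shrink:
  assumes x: "0 \<le> x" "x \<le> a" and a: "0 < a" "a \<le> 1"
    and s: "cmod s \<le> 1" "1 \<le> cmod (of_real a - s)"
  shows "cmod (of_real x - s) \<le> (1 - x * (a - x) / 2) * cmod (of_real a - s)"
proof (rule power2_le_imp_le)
  define e where "e = x * (a - x)"
  define t where "t = x / a"
  define d where "d = (cmod (of_real a - s))\<^sup>2"
  have t: "0 \<le> t" "t \<le> 1" "x = t * a" using x a by (auto simp: t_def)
  have "t * a\<^sup>2 \<le> 1 * 1" using t a by (intro mult_mono) (auto simp: abs_square_le_1)
  then have "(t * a\<^sup>2) * (1 - t) \<le> 1 - t"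
    using t mult_right_mono[of "t * a\<^sup>2" 1 "1 - t"] by simp
  moreover have "e = (t * a\<^sup>2) * (1 - t)" by (simp add: e_def t(3) algebra_simps power2_eq_square)
  ultimately have e: "0 \<le> e" "e \<le> 1 - t" using t by simp_all
  have d: "1 \<le> d" and s': "(cmod s)\<^sup>2 \<le> 1"
    using s by (auto simp: d_def abs_square_le_1)
  \<comment> \<open>Stewart's theorem for the point \<open>x = t a\<close> on the segment from 0 to
    \<open>a\<close>, with \<open>e = x (a - x)\<close>. Since \<open>|s| \<le> 1 \<le> d\<close>
    and \<open>e \<le> 1 - t\<close>, the right side is at most \<open>(1 - e) d\<close>.\<close>
  have "(cmod (of_real x - s))\<^sup>2 = t * d + (1 - t) * (cmod s)\<^sup>2 - e"
    unfolding d_def e_def power2_cmod_of_real_diff t(3) by (simp add: algebra_simps power2_eq_square)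
  also have "\<dots> \<le> t * d + (1 - t) - e"
    using s' t mult_left_le[of "(cmod s)\<^sup>2" "1-t"] by simp
  also have "\<dots> = (1 - e) * d - (1 - t - e) * (d - 1)" by (simp add: algebra_simps)
  also have "\<dots> \<le> (1 - e) * d" using d e by simp
  also have "\<dots> \<le> (1 - e / 2)\<^sup>2 * d"
    using d by (intro mult_right_mono) (auto simp: power2_eq_square algebra_simps)
  finally show "(cmod (of_real x - s))\<^sup>2 \<le> ((1 - x * (a - x) / 2) * cmod (of_real a - s))\<^sup>2"
    by (simp add: d_def e_def power_mult_distrib)
  show "0 \<le> (1 - x * (a - x) / 2) * cmod (of_real a - s)"
    using e t unfolding e_def by (intro mult_nonneg_nonneg) auto
qed

text \<open>The real part is \<open>(Re s - w |s|^2) / |1 - w s|^2\<close>. Bounding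
  \<open>|s|^2\<close> from below by \<open>|a - s| \<ge> 1\<close> makes the numerator at most an
  affine function of \<open>Re s\<close> with slope \<open>1 - 2 a w \<ge> 0\<close>. It is largest
  at \<open>Re s = a / 2\<close>, with value \<open>a / 2 - w = - a (1 - a) / 4\<close>. The
  denominator is at most \<open>9 / 4\<close> since \<open>|w s| \<le> 1 / 2\<close>.\<close>

lemma lune_Re_moebius_le:
  assumes a: "0 < a" "a < 1" and w: "w = a * (3 - a) / 4"
    and s: "cmod s \<le> 1" "1 \<le> cmod (of_real a - s)"
  shows "Re (s / (1 - of_real w * s)) \<le> - (a * (1 - a) / 9)"
proof -
  have "2 - a * (3 - a) = (1 - a) * (2 - a)" by (simp add: algebra_simps)
  moreover have "0 < (1 - a) * (2 - a)" using a by simp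
  ultimately have "a * (3 - a) < 2" by linarith
  then have w': "0 < w" "w \<le> 1/2" using a unfolding w by auto
  have "2 - a\<^sup>2 * (3 - a) = (1 - a) * (2 + 2 * a - a\<^sup>2)" by (simp add: algebra_simps power2_eq_square)
  moreover have "0 \<le> (1 - a) * (2 + 2 * a - a\<^sup>2)"
    using a abs_square_le_1[of a] by (intro mult_nonneg_nonneg) auto
  ultimately have aw: "0 \<le> 1 - 2 * a * w" unfolding w by (simp add: power2_eq_square)
  have "1 \<le> (cmod (of_real a - s))\<^sup>2" using s by (simp add: one_le_power)
  then have "1 - a\<^sup>2 + 2 * a * Re s \<le> (cmod s)\<^sup>2" unfolding power2_cmod_of_real_diff by simp
  then have "w * (1 - a\<^sup>2 + 2 * a * Re s) \<le> w * (cmod s)\<^sup>2" using w' by simp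
  then have "Re s - w * (cmod s)\<^sup>2 \<le> (1 - 2 * a * w) * Re s - w * (1 - a\<^sup>2)"
    by (simp add: algebra_simps)
  also have "\<dots> \<le> (1 - 2 * a * w) * (a / 2) - w * (1 - a\<^sup>2)"
    by (intro diff_right_mono mult_left_mono lune_Re_le[OF a(1) s] aw)
  also have "\<dots> = - (a * (1 - a) / 4)" unfolding w by (simp add: field_simps power2_eq_square)
  finally have num: "Re s - w * (cmod s)\<^sup>2 \<le> - (a * (1 - a) / 4)" .
  define D where "D = (cmod (1 - of_real w * s))\<^sup>2"
  have "cmod (of_real w * s) \<le> 1/2 * 1" unfolding norm_mult using w' s by (intro mult_mono) auto
  then have "cmod (1 - of_real w * s) \<le> 3/2" "1/2 \<le> cmod (1 - of_real w * s)"
    using norm_triangle_ineq4[of 1 "of_real w * s"] norm_triangle_ineq2[of 1 "of_real w * s"] by auto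
  then have D: "0 < D" "D \<le> 9/4"
    using power_mono[of "cmod (1 - of_real w * s)" "3/2" 2]
    by (auto simp: D_def power_divide)
  have "Re (s / (1 - of_real w * s)) = (Re s - w * (cmod s)\<^sup>2) / D"
    unfolding D_def Re_divide' cmod_power2 by (simp add: power2_eq_square algebra_simps)
  also have "\<dots> \<le> - (a * (1 - a) / 4) / D" using num D by (intro divide_right_mono) auto
  also have "\<dots> \<le> - (a * (1 - a) / 9)"
  proof -
    have "a * (1 - a) * D \<le> a * (1 - a) * (9/4)" using D a by (intro mult_left_mono) auto
    then show ?thesis using D by (simp add: field_simps)
  qed
  finally show ?thesis .
qed

lemma power_divide_fact_le_exp:
  fixes x :: real
  assumes "0 \<le> x"
  shows "x ^ n / fact n \<le> exp x"
proof -
  have "(\<Sum>k\<in>{n}. x ^ k /\<^sub>R fact k) \<le> (\<Sum>k. x ^ k /\<^sub>R fact k)"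
    using assms by (intro sum_le_suminf summable_exp_generic) auto
  then show ?thesis by (simp add: exp_def field_simps)
qed

section \<open>The hypothetical counterexample and its numerical constants\<close>

text \<open>Here \<open>z\<close> lists the zeros other than \<open>a\<close> and
  \<open>\<zeta>\<close> the critical points, with multiplicity. The assumptions are contradictory,
  as \<open>no_far_critical_points\<close> shows.\<close>

locale far_critical_points =
  fixes a :: real and m :: nat and z \<zeta> :: "nat \<Rightarrow> complex"
  assumes a_pos: "0 < a" and a_less_1: "a < 1"
    and large: "20000 \<le> a ^ 7 * (1 - a) ^ 4 * m"
    and zeros: "\<And>j. j \<in> {1..m} \<Longrightarrow> cmod (z j) \<le> 1"
    and crit: "\<And>i. i < m \<Longrightarrow> cmod (\<zeta> i) \<le> 1"
    and far: "\<And>i. i < m \<Longrightarrow> 1 \<le> cmod (of_real a - \<zeta> i)"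
    and deriv: "\<And>x. ((\<lambda>x. (x - of_real a) * (\<Prod>j=1..m. (x - z j))) has_field_derivative
                  of_nat (Suc m) * (\<Prod>i<m. (x - \<zeta> i))) (at x)"
begin

definition p :: "complex \<Rightarrow> complex" where
  "p x = (x - of_real a) * (\<Prod>j=1..m. (x - z j))"

definition q :: "complex \<Rightarrow> complex" where
  "q x = of_nat (Suc m) * (\<Prod>i<m. (x - \<zeta> i))"

text \<open>The factor by which distances to critical points shrink away from both 0 and
  \<open>a\<close>: half of the lower bound \<open>a ^ 4 * (1 - a) / 3200\<close> for
  \<open>x * (a - x)\<close> is subtracted from 1, as in \<open>lune_cmod_shrink\<close>.\<close>

definition \<theta> :: real where "\<theta> = 1 - a ^ 4 * (1 - a) / 6400"

text \<open>
  The choice \<open>a/2 < w\<close> makes the real part of \<open>s / (1 - w s)\<close> negative on the whole lune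
  \<open>|s| \<le> 1 \<le> |a - s|\<close>, while \<open>w < a\<close> keeps \<open>q\<close> exponentially small near \<open>w\<close>.
\<close>

definition w :: real where "w = a * (3 - a) / 4"

lemma deriv_p: "(p has_field_derivative q x) (at x)"
  using deriv unfolding p_def[abs_def] q_def .

lemma a_one_minus_a_le: "a * (1 - a) \<le> 1 / 4"
  using zero_le_power2[of "a - 1/2"] by (simp add: power2_eq_square algebra_simps)

lemma m_ge: "20000 \<le> a ^ 3 * (1 - a) * m"
proof -
  have "a ^ 4 * (1 - a) ^ 3 \<le> 1 * 1"
    using a_pos a_less_1 by (intro mult_mono power_le_one) auto
  then have "(a ^ 4 * (1 - a) ^ 3) * (a ^ 3 * (1 - a) * m) \<le> 1 * (a ^ 3 * (1 - a) * m)"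
    using a_pos a_less_1 by (intro mult_right_mono) auto
  moreover have "(a ^ 4 * (1 - a) ^ 3) * (a ^ 3 * (1 - a) * m) = a ^ 7 * (1 - a) ^ 4 * m"
    by algebra
  ultimately show ?thesis using large by simp
qed

lemma m_pos: "0 < m"
  using m_ge by (cases m) auto

lemma a_m_ge: "20000 \<le> a * m"
proof -
  have "a\<^sup>2 * (1 - a) \<le> 1 * 1"
    using a_pos a_less_1 by (intro mult_mono power_le_one) auto
  then have "(a\<^sup>2 * (1 - a)) * (a * m) \<le> 1 * (a * m)"
    using a_pos by (intro mult_right_mono) auto
  moreover have "(a\<^sup>2 * (1 - a)) * (a * m) = a ^ 3 * (1 - a) * m"
    by algebra
  ultimately show ?thesis using m_ge by simp
qed

lemma \<theta>_bounds: "0 \<le> \<theta>" "\<theta> \<le> 1"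
proof -
  have "a ^ 4 * (1 - a) \<le> 1 * 1"
    using a_pos a_less_1 by (intro mult_mono power_le_one) auto
  then show "0 \<le> \<theta>" by (simp add: \<theta>_def)
  show "\<theta> \<le> 1" using a_pos a_less_1 by (simp add: \<theta>_def)
qed

text \<open>\<open>\<theta> ^ m \<le> exp (- x)\<close>, and the sixth term of the exponential
  series already makes \<open>exp x\<close> exceed \<open>200 * m\<close>: it is of order 6 in
  \<open>m\<close>, and the fifth power of \<open>large\<close> absorbs all but one factor
  \<open>m\<close>.\<close>

lemma \<theta>_power_le: "\<theta> ^ m \<le> 1 / (200 * m)"
proof -
  define x where "x = a ^ 4 * (1 - a) / 6400 * m"
  define M where "M = a ^ 7 * (1 - a) ^ 4 * m"
  \<comment> \<open>Chosen so that \<open>x ^ 6 * 6400 ^ 6 = m * Y\<close>; a constant lower bound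
    on \<open>Y\<close> then suffices.\<close>
  define Y where "Y = real m ^ 5 * a ^ 24 * (1 - a) ^ 6"
  have x0: "0 < x" using a_pos a_less_1 m_pos by (simp add: x_def)
  have "20000 ^ 5 \<le> M ^ 5" using large by (intro power_mono) (auto simp: M_def)
  also have "M ^ 5 = (a ^ 11 * (1 - a) ^ 14) * Y"
    unfolding M_def Y_def by algebra
  also have "\<dots> \<le> (1 / 4) ^ 11 * Y"
  proof (rule mult_right_mono)
    have "(a * (1 - a)) ^ 11 * (1 - a) ^ 3 \<le> (1 / 4) ^ 11 * 1"
      using a_pos a_less_1 a_one_minus_a_le by (intro mult_mono power_mono power_le_one) auto
    moreover have "(a * (1 - a)) ^ 11 * (1 - a) ^ 3 = a ^ 11 * (1 - a) ^ 14" by algebra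
    ultimately show "a ^ 11 * (1 - a) ^ 14 \<le> (1 / 4) ^ 11" by simp
    show "0 \<le> Y" using a_pos a_less_1 by (simp add: Y_def)
  qed
  finally have Y: "200 * 720 * 6400 ^ 6 \<le> Y" by (simp add: power_divide)
  have "200 * m * 720 * 6400 ^ 6 \<le> m * Y" using mult_left_mono[OF Y, of m] by simp
  also have "\<dots> = x ^ 6 * 6400 ^ 6" unfolding x_def Y_def by (simp add: power_mult_distrib power_divide) algebra
  finally have "200 * m \<le> x ^ 6 / 720" by simp
  also have "\<dots> \<le> exp x" using power_divide_fact_le_exp[of x 6] x0 by (simp add: fact_numeral)
  finally have "exp (- x) \<le> 1 / (200 * m)"
    using m_pos by (simp add: exp_minus field_simps)
  moreover have "\<theta> ^ m \<le> exp (- x)"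
  proof -
    have "\<theta> \<le> exp (- (a ^ 4 * (1 - a) / 6400))"
      using exp_ge_add_one_self[of "- (a ^ 4 * (1 - a) / 6400)"] by (simp add: \<theta>_def)
    then have "\<theta> ^ m \<le> exp (- (a ^ 4 * (1 - a) / 6400)) ^ m"
      using \<theta>_bounds by (intro power_mono)
    also have "\<dots> = exp (- x)" by (simp add: x_def exp_of_nat_mult[symmetric] mult.commute)
    finally show ?thesis .
  qed
  ultimately show ?thesis by simp
qed

section \<open>Smallness of the derivative \<open>q\<close> to the left of \<open>a\<close>\<close>

lemma cmod_q_le:
  assumes "\<And>i. i < m \<Longrightarrow> cmod (x - \<zeta> i) \<le> b * cmod (of_real a - \<zeta> i)"
  shows "cmod (q x) \<le> b ^ m * cmod (q (of_real a))"
proof -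
  have "(\<Prod>i<m. cmod (x - \<zeta> i)) \<le> (\<Prod>i<m. b * cmod (of_real a - \<zeta> i))"
    using assms by (intro prod_mono) auto
  also have "\<dots> = b ^ m * (\<Prod>i<m. cmod (of_real a - \<zeta> i))"
    by (simp add: prod.distrib)
  finally have "real (Suc m) * (\<Prod>i<m. cmod (x - \<zeta> i))
      \<le> real (Suc m) * (b ^ m * (\<Prod>i<m. cmod (of_real a - \<zeta> i)))"
    by (intro mult_left_mono) auto
  then show ?thesis unfolding q_def norm_mult norm_of_nat prod_norm[symmetric] by (simp add: mult_ac)
qed

lemma cmod_q_a_ge: "real m \<le> cmod (q (of_real a))"
proof -
  have "1 \<le> (\<Prod>i<m. cmod (of_real a - \<zeta> i))"
    using far by (intro prod_ge_1) auto
  then have "real (Suc m) * 1 \<le> real (Suc m) * (\<Prod>i<m. cmod (of_real a - \<zeta> i))"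
    by (intro mult_left_mono) auto
  moreover have "cmod (q (of_real a)) = real (Suc m) * (\<Prod>i<m. cmod (of_real a - \<zeta> i))"
    unfolding q_def norm_mult norm_of_nat prod_norm ..
  moreover have "real m \<le> real (Suc m) * 1" by simp
  ultimately show ?thesis by (metis order_trans)
qed

lemma cmod_q_segment_le:
  assumes "0 \<le> x" "x \<le> a"
  shows "cmod (q (of_real x)) \<le> cmod (q (of_real a))"
proof -
  have "cmod (of_real x - \<zeta> i) \<le> 1 * cmod (of_real a - \<zeta> i)" if "i < m" for i
  proof -
    have "cmod (of_real x - \<zeta> i) \<le> (1 - x * (a - x) / 2) * cmod (of_real a - \<zeta> i)"
      using assms a_pos a_less_1 crit[OF that] far[OF that] by (intro lune_cmod_shrink) auto
    also have "\<dots> \<le> 1 * cmod (of_real a - \<zeta> i)"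
      using assms by (intro mult_right_mono) auto
    finally show ?thesis .
  qed
  from cmod_q_le[OF this] show ?thesis by simp
qed

text \<open>The endpoints come from later needs: the left one is the error per zero in
  \<open>sum_one_minus_cmod_zeros_le\<close>, and the right one keeps the remainder in
  \<open>cmod_p_near_a_ge\<close> small. In each half of the segment one of \<open>x\<close> and
  \<open>a - x\<close> is at least \<open>a / 2\<close>, and the endpoint bounds the other.\<close>

lemma cmod_q_inner_segment_le:
  assumes "a ^ 3 * (1 - a) / 1600 \<le> x" "x \<le> a - a\<^sup>2 / 4000"
  shows "cmod (q (of_real x)) \<le> \<theta> ^ m * cmod (q (of_real a))"
proof (rule cmod_q_le)
  fix i assume i: "i < m"
  have c0: "0 \<le> a ^ 3 * (1 - a) / 1600" using a_pos a_less_1 by simp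
  have x: "0 \<le> x" "x \<le> a" using assms c0 a_pos by (auto intro: order_trans)
  have *: "a ^ 4 * (1 - a) / 3200 \<le> x * (a - x)"
  proof (cases "x \<le> a / 2")
    case True
    have "a ^ 4 * (1 - a) / 3200 = a ^ 3 * (1 - a) / 1600 * (a / 2)"
      by (simp add: power_numeral_reduce)
    also have "\<dots> \<le> x * (a - x)" using True assms(1) a_pos x by (intro mult_mono) auto
    finally show ?thesis .
  next
    case False
    have "a ^ 4 * (1 - a) = a ^ 3 * (a * (1 - a))" by algebra
    also have "\<dots> \<le> a ^ 3 * (1 / 4)" using a_pos a_one_minus_a_le by (intro mult_left_mono) auto
    moreover have "0 \<le> a ^ 3" using a_pos by simp
    ultimately have "a ^ 4 * (1 - a) / 3200 \<le> a ^ 3 / 8000" by linarith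
    also have "\<dots> = (a / 2) * (a\<^sup>2 / 4000)" by (simp add: power_numeral_reduce)
    also have "\<dots> \<le> x * (a - x)" using False assms(2) a_pos x by (intro mult_mono) auto
    finally show ?thesis .
  qed
  have "cmod (of_real x - \<zeta> i) \<le> (1 - x * (a - x) / 2) * cmod (of_real a - \<zeta> i)"
    using x a_pos a_less_1 crit[OF i] far[OF i] by (intro lune_cmod_shrink) auto
  also have "\<dots> \<le> \<theta> * cmod (of_real a - \<zeta> i)"
    using * by (intro mult_right_mono) (auto simp: \<theta>_def mult.commute)
  finally show "cmod (of_real x - \<zeta> i) \<le> \<theta> * cmod (of_real a - \<zeta> i)" .
qed

text \<open>At \<open>w\<close> the distances shrink by the factor \<open>1 - 3 a^2 / 32\<close>.
  Moving by \<open>3 a^2 / 64\<close> spends half of this gain, because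
  \<open>|a - \<zeta> i| \<ge> 1\<close>.\<close>

lemma cmod_q_disk_le:
  assumes "cmod (x - of_real w) \<le> 3 * a\<^sup>2 / 64"
  shows "cmod (q x) \<le> \<theta> ^ m * cmod (q (of_real a))"
proof (rule cmod_q_le)
  fix i assume i: "i < m"
  have wa: "0 \<le> w" "w \<le> a" using a_pos a_less_1 by (auto simp: w_def field_simps)
  have "w * (a - w) = a\<^sup>2 * ((3 - a) * (1 + a)) / 16"
    by (simp add: w_def field_simps power2_eq_square)
  moreover have "a\<^sup>2 * 3 \<le> a\<^sup>2 * ((3 - a) * (1 + a))"
    using a_pos a_less_1 mult_left_mono[of a 2 a]
    by (intro mult_left_mono) (auto simp: algebra_simps)
  ultimately have ww: "3 * a\<^sup>2 / 16 \<le> w * (a - w)" by simp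
  have "a ^ 4 * (1 - a) = a\<^sup>2 * (a\<^sup>2 * (1 - a))" by algebra
  also have "\<dots> \<le> a\<^sup>2 * (1 * 1)"
    using a_pos a_less_1 by (intro mult_left_mono mult_mono power_le_one) auto
  finally have "a ^ 4 * (1 - a) \<le> a\<^sup>2" by simp
  moreover have "0 \<le> a\<^sup>2" by simp
  ultimately have th: "1 - 3 * a\<^sup>2 / 64 \<le> \<theta>" unfolding \<theta>_def by linarith
  have "cmod (x - \<zeta> i) \<le> cmod (x - of_real w) + cmod (of_real w - \<zeta> i)"
    using norm_triangle_ineq[of "x - of_real w" "of_real w - \<zeta> i"] by simp
  also have "cmod (x - of_real w) \<le> 3 * a\<^sup>2 / 64 * cmod (of_real a - \<zeta> i)"
    using assms far[OF i] mult_left_mono[of 1 "cmod (of_real a - \<zeta> i)" "3 * a\<^sup>2 / 64"] by simp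
  also have "cmod (of_real w - \<zeta> i) \<le> (1 - w * (a - w) / 2) * cmod (of_real a - \<zeta> i)"
    using wa a_pos a_less_1 crit[OF i] far[OF i] by (intro lune_cmod_shrink) auto
  also have "\<dots> \<le> (1 - 3 * a\<^sup>2 / 32) * cmod (of_real a - \<zeta> i)"
    using ww by (intro mult_right_mono) auto
  finally have "cmod (x - \<zeta> i) \<le> (1 - 3 * a\<^sup>2 / 64) * cmod (of_real a - \<zeta> i)"
    by (simp add: algebra_simps)
  also have "\<dots> \<le> \<theta> * cmod (of_real a - \<zeta> i)" using th by (intro mult_right_mono) auto
  finally show "cmod (x - \<zeta> i) \<le> \<theta> * cmod (of_real a - \<zeta> i)" .
qed

section \<open>Lower bounds for \<open>p\<close> to the left of \<open>a\<close>\<close>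

text \<open>As \<open>p\<close> vanishes at \<open>a\<close>, its value at \<open>b\<close> is minus
  the integral of \<open>q\<close> from \<open>b\<close> to \<open>a\<close>. This is close to
  \<open>- q(a) / S(a)\<close> with \<open>S = q' / q\<close>, and \<open>|S(a)| \<le> m\<close>.
  The remainder and the boundary term at \<open>b\<close> cost one eighth each.\<close>

lemma cmod_p_near_a_ge:
  defines "b \<equiv> a - a\<^sup>2 / 4000"
  shows "3 / 4 * cmod (q (of_real a)) / m \<le> cmod (p (of_real b))"
proof -
  define Q where "Q = cmod (q (of_real a))"
  define S where "S x = (\<Sum>i<m. 1 / (x - \<zeta> i))" for x
  define T where "T x = (\<Sum>i<m. 1 / (x - \<zeta> i)\<^sup>2)" for x
  define A where "A = closed_segment (complex_of_real b) (of_real a)"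
  have "a\<^sup>2 \<le> a" using a_pos a_less_1 by (simp add: power2_eq_square)
  then have b: "3 / 4 * a \<le> b" "b \<le> a" using a_pos by (auto simp: b_def)
  have A: "\<exists>r. x = of_real r \<and> b \<le> r \<and> r \<le> a" if "x \<in> A" for x
    using that b unfolding A_def closed_segment_of_real by (auto simp: closed_segment_eq_real_ivl)
  have dist: "3 / 4 \<le> cmod (of_real r - \<zeta> i)" if "b \<le> r" "r \<le> a" "i < m" for r i
    using norm_triangle_ineq[of "of_real r - \<zeta> i" "of_real (a - r)"] far[OF that(3)] that b a_less_1 a_pos
    by (simp add: norm_of_real del: of_real_diff) (simp add: algebra_simps)
  have S_ge: "m * (a / 16) \<le> cmod (S (of_real r))" if r: "b \<le> r" "r \<le> a" for r
  proof -
    have "a / 16 \<le> Re (1 / (of_real r - \<zeta> i))" if i: "i < m" for i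
    proof -
      let ?d = "cmod (of_real r - \<zeta> i)"
      have "?d \<le> 2" using norm_triangle_ineq4[of "of_real r" "\<zeta> i"] crit[OF i] r b a_less_1 a_pos by simp
      then have "?d\<^sup>2 \<le> 2\<^sup>2" by (intro power_mono) auto
      moreover have "0 < ?d\<^sup>2" using dist[OF r i] by (intro zero_less_power) linarith
      moreover have "a / 4 \<le> r - Re (\<zeta> i)" using lune_Re_le[OF a_pos crit[OF i] far[OF i]] b r by simp
      ultimately have "a / 4 / 2\<^sup>2 \<le> (r - Re (\<zeta> i)) / ?d\<^sup>2" using a_pos by (intro frac_le) auto
      then show ?thesis by (simp add: Re_divide' cmod_power2)
    qed
    then have "(\<Sum>i<m. a / 16) \<le> Re (S (of_real r))"
      unfolding S_def Re_sum by (intro sum_mono) auto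
    then show ?thesis using complex_Re_le_cmod[of "S (of_real r)"] by simp
  qed
  have T_le: "cmod (T (of_real r)) \<le> m * (16 / 9)" if r: "b \<le> r" "r \<le> a" for r
  proof -
    have "cmod (1 / (of_real r - \<zeta> i)\<^sup>2) \<le> 16 / 9" if i: "i < m" for i
    proof -
      have "(3/4)\<^sup>2 \<le> (cmod (of_real r - \<zeta> i))\<^sup>2" using dist[OF r i] by (intro power_mono) auto
      then have "1 / (cmod (of_real r - \<zeta> i))\<^sup>2 \<le> 1 / (3/4)\<^sup>2" by (intro divide_left_mono) (auto simp: power2_eq_square)
      then show ?thesis by (simp add: norm_divide norm_power power_divide)
    qed
    then have "cmod (T (of_real r)) \<le> (\<Sum>i<m. 16 / 9)" unfolding T_def by (intro sum_norm_le) auto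
    then show ?thesis by simp
  qed
  have ma: "0 < m * (a / 16)" using m_pos a_pos by simp
  \<comment> \<open>Integrating \<open>q = q' / S\<close> by parts leaves the boundary term \<open>q / S\<close> and a remainder of
    relative size \<open>1 / m\<close>.\<close>
  define \<Phi> where "\<Phi> x = p x - q x / S x" for x
  have "cmod (\<Phi> (of_real b) - \<Phi> (of_real a)) \<le> Q * (m * (16 / 9)) / (m * (a / 16))\<^sup>2 * cmod (complex_of_real b - of_real a)"
  proof (rule field_differentiable_bound[where S = A and f' = "\<lambda>x. - (q x * T x) / (S x)\<^sup>2"])
    fix x assume "x \<in> A"
    then obtain r where r: "x = of_real r" "b \<le> r" "r \<le> a" using A by blast
    have ne: "x \<noteq> \<zeta> i" if "i < m" for i using dist[OF r(2,3) that] r(1) by auto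
    have S0: "S x \<noteq> 0" using S_ge[OF r(2,3)] ma r(1) by auto
    have "(q has_field_derivative q x * S x) (at x)"
      unfolding q_def[abs_def] S_def mult.assoc
      by (intro DERIV_cmult has_field_derivative_prod_roots) (use ne in auto)
    moreover have "(S has_field_derivative - T x) (at x)"
      unfolding S_def[abs_def] T_def by (intro has_field_derivative_sum_inverse) (use ne in auto)
    ultimately have "(\<Phi> has_field_derivative q x - (q x * S x * S x - q x * (- T x)) / (S x * S x)) (at x)"
      unfolding \<Phi>_def[abs_def] using S0 by (intro DERIV_diff DERIV_divide deriv_p) auto
    moreover have "q x - (q x * S x * S x - q x * (- T x)) / (S x * S x) = - (q x * T x) / (S x)\<^sup>2"
      using S0 by (simp add: field_simps power2_eq_square)
    ultimately show "(\<Phi> has_field_derivative - (q x * T x) / (S x)\<^sup>2) (at x within A)"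
      by (simp add: has_field_derivative_at_within)
    have "cmod (q x) \<le> Q" unfolding r(1) Q_def using r b a_pos by (intro cmod_q_segment_le) auto
    then have "cmod (q x) * cmod (T x) \<le> Q * (m * (16 / 9))"
      using T_le[OF r(2,3)] r(1) by (intro mult_mono) (auto simp: Q_def)
    moreover have "(m * (a / 16))\<^sup>2 \<le> (cmod (S x))\<^sup>2"
      using S_ge[OF r(2,3)] r(1) ma by (intro power_mono) auto
    ultimately show "cmod (- (q x * T x) / (S x)\<^sup>2) \<le> Q * (m * (16 / 9)) / (m * (a / 16))\<^sup>2"
      using ma unfolding norm_divide norm_minus_cancel norm_mult norm_power
      by (intro frac_le zero_less_power) (auto simp: Q_def)
  qed (auto simp: A_def)
  also have "cmod (complex_of_real b - of_real a) = a\<^sup>2 / 4000"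
    by (simp add: b_def norm_power)
  \<comment> \<open>The length \<open>a^2 / 4000\<close> cancels the factor \<open>a^2\<close> from
    the lower bound on \<open>|S|^2\<close>, leaving a constant below \<open>1 / 8\<close>.\<close>
  also have "Q * (m * (16 / 9)) / (m * (a / 16))\<^sup>2 * (a\<^sup>2 / 4000) = (4096 / 36000) * (Q / m)"
    using a_pos m_pos by (simp add: field_simps power2_eq_square)
  also have "\<dots> \<le> (1 / 8) * (Q / m)" by (intro mult_right_mono) (auto simp: Q_def)
  finally have 1: "cmod (\<Phi> (of_real b) - \<Phi> (of_real a)) \<le> Q / (8 * m)" by simp
  have 2: "Q / m \<le> cmod (\<Phi> (of_real a))"
  proof -
    have "cmod (S (of_real a)) \<le> (\<Sum>i<m. 1)"
      unfolding S_def using far by (intro sum_norm_le) (auto simp: norm_divide divide_le_eq_1)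
    moreover have "0 < cmod (S (of_real a))" using S_ge[of a] b ma by linarith
    ultimately have "Q / m \<le> Q / cmod (S (of_real a))"
      by (intro divide_left_mono) (auto simp: Q_def m_pos)
    then show ?thesis by (simp add: \<Phi>_def p_def norm_divide Q_def)
  qed
  have 3: "cmod (q (of_real b) / S (of_real b)) \<le> Q / (8 * m)"
  proof -
    have "a ^ 3 * (1 - a) \<le> a * 1"
      using a_pos a_less_1 power_decreasing[of 1 3 a] by (intro mult_mono) auto
    then have "cmod (q (of_real b)) \<le> \<theta> ^ m * Q"
      unfolding Q_def using b a_pos by (intro cmod_q_inner_segment_le) (auto simp: b_def)
    also have "\<dots> \<le> 1 / (200 * m) * Q" using \<theta>_power_le by (intro mult_right_mono) (auto simp: Q_def)
    finally have "cmod (q (of_real b) / S (of_real b)) \<le> 1 / (200 * m) * Q / (m * (a / 16))"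
      unfolding norm_divide using S_ge[of b] b ma by (intro frac_le) (auto simp: Q_def)
    also have "\<dots> = (16 / 200 / (a * m)) * (Q / m)" using m_pos a_pos by (simp add: field_simps)
    also have "\<dots> \<le> (1 / 8) * (Q / m)"
      using a_m_ge by (intro mult_right_mono) (auto simp: Q_def divide_le_eq)
    finally show ?thesis by simp
  qed
  have "cmod (\<Phi> (of_real a)) \<le> cmod (\<Phi> (of_real b) - \<Phi> (of_real a)) + cmod (\<Phi> (of_real b))"
    by (metis norm_minus_commute norm_triangle_sub add.commute)
  moreover have "cmod (\<Phi> (of_real b)) \<le> cmod (p (of_real b)) + cmod (q (of_real b) / S (of_real b))"
    unfolding \<Phi>_def by (rule norm_triangle_ineq4)
  ultimately have "Q / m - Q / (8 * m) - Q / (8 * m) \<le> cmod (p (of_real b))"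
    using 1 2 3 by linarith
  moreover have "Q / m - Q / (8 * m) - Q / (8 * m) = 3 / 4 * Q / m" using m_pos by (simp add: field_simps)
  ultimately show ?thesis by (simp add: Q_def)
qed

text \<open>Between \<open>c\<close> and \<open>b\<close> the derivative is at most
  \<open>Q / (200 m)\<close>, so \<open>p\<close> hardly moves from its value at
  \<open>b\<close>.\<close>

lemma cmod_p_ge:
  assumes "a ^ 3 * (1 - a) / 1600 \<le> c" "c \<le> a - a\<^sup>2 / 4000"
  shows "cmod (q (of_real a)) / (2 * m) \<le> cmod (p (of_real c))"
proof -
  define b where "b = a - a\<^sup>2 / 4000"
  define Q where "Q = cmod (q (of_real a))"
  have c0: "0 \<le> a ^ 3 * (1 - a) / 1600" using a_pos a_less_1 by simp
  have "cmod (p (of_real b) - p (of_real c)) \<le> Q / (200 * m) * cmod (complex_of_real b - of_real c)"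
  proof (rule field_differentiable_bound[where S = "closed_segment (complex_of_real c) (of_real b)" and f' = q])
    fix x assume "x \<in> closed_segment (complex_of_real c) (of_real b)"
    then obtain r where r: "x = of_real r" "c \<le> r" "r \<le> b"
      using assms unfolding closed_segment_of_real by (auto simp: closed_segment_eq_real_ivl b_def)
    have "cmod (q x) \<le> \<theta> ^ m * Q"
      unfolding r(1) Q_def using r assms by (intro cmod_q_inner_segment_le) (auto simp: b_def)
    also have "\<dots> \<le> 1 / (200 * m) * Q" using \<theta>_power_le by (intro mult_right_mono) (auto simp: Q_def)
    finally show "cmod (q x) \<le> Q / (200 * m)" by simp
  qed (auto intro: deriv_p has_field_derivative_at_within)
  also have "\<dots> \<le> Q / (200 * m) * 1"
  proof (rule mult_left_mono)
    have "0 \<le> a\<^sup>2" by simp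
    then have "\<bar>b - c\<bar> \<le> 1" using assms c0 a_less_1 unfolding b_def by linarith
    then show "cmod (complex_of_real b - of_real c) \<le> 1" by (simp flip: of_real_diff)
  qed (simp add: Q_def)
  finally have "cmod (p (of_real b)) - cmod (p (of_real c)) \<le> Q / (200 * m)"
    using norm_triangle_ineq2[of "p (of_real b)" "p (of_real c)"] by linarith
  then have "3 / 4 * Q / m - Q / (200 * m) \<le> cmod (p (of_real c))"
    using cmod_p_near_a_ge unfolding b_def Q_def by linarith
  moreover have "Q / (2 * m) \<le> 3 / 4 * Q / m - Q / (200 * m)" using m_pos by (simp add: field_simps Q_def)
  ultimately show ?thesis by (simp add: Q_def)
qed

section \<open>Location of the zeros\<close>

text \<open>Close to 0, \<open>|c - z j| \<le> c + |z j| \<le> exp (c - (1 - |z j|))\<close>, while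
  \<open>|p(c)| \<ge> 1 / 2\<close>. Comparing exponents gives the bound.\<close>

lemma sum_one_minus_cmod_zeros_le: "(\<Sum>j=1..m. 1 - cmod (z j)) \<le> a ^ 3 * (1 - a) / 1600 * m + 1"
proof -
  define c where "c = a ^ 3 * (1 - a) / 1600"
  have c: "0 \<le> c" using a_pos a_less_1 by (simp add: c_def)
  have "a ^ 3 * (1 - a) \<le> a * 1"
    using a_pos a_less_1 power_decreasing[of 1 3 a] by (intro mult_mono) auto
  moreover have "a\<^sup>2 \<le> a" using a_pos a_less_1 by (simp add: power2_eq_square)
  ultimately have ca: "c \<le> a - a\<^sup>2 / 4000" "c \<le> a" using a_pos by (auto simp: c_def)
  have "1 / 2 = m / (2 * m)" using m_pos by simp
  also have "\<dots> \<le> cmod (q (of_real a)) / (2 * m)"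
    using cmod_q_a_ge by (intro divide_right_mono) auto
  also have "\<dots> \<le> cmod (p (of_real c))" using ca by (intro cmod_p_ge) (auto simp: c_def)
  also have "\<dots> = (a - c) * (\<Prod>j=1..m. cmod (of_real c - z j))"
    using ca by (simp add: p_def norm_mult prod_norm[symmetric] flip: of_real_diff)
  also have "\<dots> \<le> 1 * (\<Prod>j=1..m. exp (c - (1 - cmod (z j))))"
  proof (intro mult_mono prod_mono conjI)
    fix j
    have "cmod (of_real c - z j) \<le> c + cmod (z j)"
      using norm_triangle_ineq4[of "of_real c" "z j"] c by simp
    also have "\<dots> \<le> exp (c - (1 - cmod (z j)))"
      using exp_ge_add_one_self[of "c - (1 - cmod (z j))"] by simp
    finally show "cmod (of_real c - z j) \<le> exp (c - (1 - cmod (z j)))" .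
  qed (use c a_less_1 in \<open>auto intro: prod_nonneg\<close>)
  also have "\<dots> = exp (c * m - (\<Sum>j=1..m. 1 - cmod (z j)))"
    by (simp add: exp_sum[symmetric] sum_subtractf mult.commute)
  finally have "1 / 2 \<le> exp (c * m - (\<Sum>j=1..m. 1 - cmod (z j)))" .
  moreover have "exp (- 1 :: real) \<le> 1 / 2"
    using exp_ge_add_one_self[of 1] by (simp add: exp_minus field_simps)
  ultimately have "exp (- 1) \<le> exp (c * m - (\<Sum>j=1..m. 1 - cmod (z j)))" by (rule order_trans[rotated])
  then show ?thesis by (simp add: c_def)
qed

lemma w_bounds: "a / 2 \<le> w" "w \<le> 1 / 2" "w \<le> 3 / 4 * a"
proof -
  have "a * a \<le> a * 1" using a_pos a_less_1 by (intro mult_left_mono) auto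
  then show "a / 2 \<le> w" using a_pos by (simp add: w_def algebra_simps)
  show "w \<le> 3 / 4 * a" using a_pos by (simp add: w_def algebra_simps)
  have "2 - a * (3 - a) = (1 - a) * (2 - a)" by (simp add: algebra_simps)
  moreover have "0 < (1 - a) * (2 - a)" using a_less_1 by simp
  ultimately show "w \<le> 1 / 2" unfolding w_def by linarith
qed

lemma cmod_p_w_ge: "cmod (q (of_real a)) / (2 * m) \<le> cmod (p (of_real w))"
proof (rule cmod_p_ge)
  have "a ^ 3 * (1 - a) \<le> a * 1"
    using a_pos a_less_1 power_decreasing[of 1 3 a] by (intro mult_mono) auto
  then show "a ^ 3 * (1 - a) / 1600 \<le> w" using w_bounds a_pos by simp
  have "a\<^sup>2 \<le> a" using a_pos a_less_1 by (simp add: power2_eq_square)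
  then show "w \<le> a - a\<^sup>2 / 4000" using w_bounds a_pos by simp
qed

text \<open>On the disk of this radius about \<open>w\<close> the derivative is so small that
  \<open>p\<close> cannot drop from \<open>|p(w)| \<ge> Q / (2 m)\<close> to 0.\<close>

lemma cmod_zero_minus_w_ge:
  assumes "j \<in> {1..m}"
  shows "3 * a\<^sup>2 / 64 \<le> cmod (z j - of_real w)"
proof (rule ccontr)
  define Q where "Q = cmod (q (of_real a))"
  assume "\<not> 3 * a\<^sup>2 / 64 \<le> cmod (z j - of_real w)"
  then have z: "cmod (z j - of_real w) < 3 * a\<^sup>2 / 64" by simp
  have Q: "0 < Q" using cmod_q_a_ge m_pos unfolding Q_def by linarith
  have "cmod (p (of_real w) - p (z j)) \<le> Q / (200 * m) * cmod (of_real w - z j)"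
  proof (rule field_differentiable_bound[where S = "cball (of_real w) (3 * a\<^sup>2 / 64)" and f' = q])
    fix x assume "x \<in> cball (complex_of_real w) (3 * a\<^sup>2 / 64)"
    then have "cmod (q x) \<le> \<theta> ^ m * Q"
      unfolding Q_def by (intro cmod_q_disk_le) (simp add: dist_norm norm_minus_commute)
    also have "\<dots> \<le> 1 / (200 * m) * Q" using \<theta>_power_le by (intro mult_right_mono) (auto simp: Q_def)
    finally show "cmod (q x) \<le> Q / (200 * m)" by simp
  qed (use z a_pos in \<open>auto intro: deriv_p has_field_derivative_at_within simp: dist_norm norm_minus_commute\<close>)
  also have "\<dots> \<le> Q / (200 * m) * 1"
  proof (rule mult_left_mono)
    have "a\<^sup>2 \<le> 1" using a_pos a_less_1 by (simp add: abs_square_le_1)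
    then show "cmod (of_real w - z j) \<le> 1" using z by (simp add: norm_minus_commute)
  qed (use Q in auto)
  also have "p (z j) = 0" using assms by (auto simp: p_def)
  finally have "Q / (2 * m) \<le> Q / (200 * m)" using cmod_p_w_ge by (simp add: Q_def)
  then show False using Q m_pos by (simp add: field_simps)
qed

text \<open>\<open>q / p\<close> at \<open>w\<close> is tiny and equals \<open>1 / (w - a)\<close>
  plus the sum over the other zeros, so that sum nearly cancels the single term from
  \<open>a\<close>.\<close>

lemma cmod_sum_inverse_zeros_minus_w_le: "cmod (\<Sum>j=1..m. 1 / (z j - of_real w)) \<le> 5 / a"
proof -
  define Q where "Q = cmod (q (of_real a))"
  define T where "T = (\<Sum>j=1..m. 1 / (of_real w - z j))"
  have Q: "0 < Q" using cmod_q_a_ge m_pos unfolding Q_def by linarith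
  have ne: "of_real w \<noteq> z j" if "j \<in> {1..m}" for j using cmod_zero_minus_w_ge[OF that] a_pos by auto
  have wa: "w < a" using w_bounds a_pos by simp
  define v where "v = complex_of_real w - of_real a"
  have v: "v \<noteq> 0" "a / 4 \<le> cmod v"
    using w_bounds wa a_pos by (auto simp: v_def simp flip: of_real_diff)
  have "(p has_field_derivative 1 * (\<Prod>j=1..m. (of_real w - z j))
      + (\<Prod>j=1..m. (of_real w - z j)) * T * v) (at (of_real w))"
    unfolding p_def[abs_def] T_def v_def using ne
    by (intro DERIV_mult has_field_derivative_prod_roots) (auto intro!: derivative_eq_intros)
  from DERIV_unique[OF deriv_p this] have "q (of_real w) = p (of_real w) * (1 / v + T)"
    using v by (simp add: p_def v_def[symmetric] algebra_simps)
  then have "cmod (p (of_real w)) * cmod (1 / v + T) = cmod (q (of_real w))" by (simp add: norm_mult)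
  also have "\<dots> \<le> \<theta> ^ m * Q"
    unfolding Q_def using a_pos by (intro cmod_q_disk_le) auto
  also have "\<dots> \<le> 1 / (200 * m) * Q" using \<theta>_power_le by (intro mult_right_mono) (auto simp: Q_def)
  finally have "Q / (2 * m) * cmod (1 / v + T) \<le> Q / (2 * m) * (1 / 100)"
    using mult_right_mono[OF cmod_p_w_ge, of "cmod (1 / v + T)"] by (simp add: Q_def)
  moreover have "0 < Q / (2 * m)" using Q m_pos by simp
  ultimately have "cmod (1 / v + T) \<le> 1 / 100" by (rule mult_left_le_imp_le)
  moreover have "cmod (1 / v) \<le> 4 / a"
    using v a_pos by (simp add: norm_divide field_simps)
  ultimately have "cmod T \<le> 4 / a + 1 / 100"
    using norm_triangle_ineq4[of "1 / v + T" "1 / v"] by simp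
  also have "\<dots> \<le> 4 / a + 1 / a" using a_pos a_less_1 by (simp add: field_simps)
  finally have "cmod T \<le> 5 / a" by simp
  moreover have "(\<Sum>j=1..m. 1 / (z j - of_real w)) = - T"
    unfolding T_def sum_negf[symmetric] by (intro sum.cong) (auto simp: minus_divide_right)
  ultimately show ?thesis by simp
qed

section \<open>The sums of \<open>s / (1 - w s)\<close> over zeros and critical points\<close>

text \<open>Replacing the conjugate of \<open>z / (1 - w z)\<close> by \<open>1 / (z - w)\<close>
  costs a multiple of \<open>1 - |z|\<close>, whose sum is already bounded; 86 rounds up
  \<open>256 / 3\<close>.\<close>

lemma cmod_sum_moebius_zeros_le:
  "cmod (\<Sum>j=1..m. z j / (1 - of_real w * z j)) \<le> 5 / a + 86 / a\<^sup>2 * (a ^ 3 * (1 - a) / 1600 * m + 1)"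
proof -
  define g where "g j = cnj (z j / (1 - of_real w * z j))" for j
  have g: "cmod (g j - 1 / (z j - of_real w)) \<le> 86 / a\<^sup>2 * (1 - cmod (z j))" if j: "j \<in> {1..m}" for j
  proof -
    define d e where "d = 1 - of_real w * cnj (z j)" and "e = z j - of_real w"
    have e: "3 * a\<^sup>2 / 64 \<le> cmod e" using cmod_zero_minus_w_ge[OF j] by (simp add: e_def)
    have "cmod (of_real w * cnj (z j)) \<le> 1 / 2 * 1"
      unfolding norm_mult using w_bounds a_pos zeros[OF j] by (intro mult_mono) auto
    then have d: "1 / 2 \<le> cmod d"
      using norm_triangle_ineq2[of 1 "of_real w * cnj (z j)"] by (simp add: d_def)
    have "0 < 3 * a\<^sup>2 / 64" using a_pos by simp
    then have ne: "d \<noteq> 0" "e \<noteq> 0" using d e by auto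
    have "g j = cnj (z j) / d" by (simp add: g_def d_def)
    then have "g j - 1 / e = (cnj (z j) * e - d) / (d * e)"
      using ne by (simp add: diff_frac_eq)
    \<comment> \<open>The two terms agree on the unit circle.\<close>
    also have "cnj (z j) * e - d = of_real ((cmod (z j))\<^sup>2 - 1)"
      by (simp add: d_def e_def algebra_simps complex_norm_square flip: of_real_power)
    finally have "cmod (g j - 1 / e) = (1 - (cmod (z j))\<^sup>2) / (cmod d * cmod e)"
      using zeros[OF j] by (simp add: norm_divide norm_mult abs_square_le_1 del: of_real_diff of_real_power)
    also have "\<dots> \<le> (2 * (1 - cmod (z j))) / (1 / 2 * (3 * a\<^sup>2 / 64))"
    proof (rule frac_le)
      have "0 \<le> (1 - cmod (z j))\<^sup>2" by simp
      then show "1 - (cmod (z j))\<^sup>2 \<le> 2 * (1 - cmod (z j))" by (simp add: power2_eq_square algebra_simps)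
      show "1 / 2 * (3 * a\<^sup>2 / 64) \<le> cmod d * cmod e" using d e a_pos by (intro mult_mono) auto
    qed (use zeros[OF j] a_pos in auto)
    also have "\<dots> = (256 / 3) / a\<^sup>2 * (1 - cmod (z j))" by (simp add: field_simps)
    also have "\<dots> \<le> 86 / a\<^sup>2 * (1 - cmod (z j))"
      using zeros[OF j] by (intro mult_right_mono divide_right_mono) auto
    finally show ?thesis by (simp add: e_def)
  qed
  have "cmod (\<Sum>j=1..m. z j / (1 - of_real w * z j)) = cmod (\<Sum>j=1..m. g j)"
    unfolding g_def cnj_sum[symmetric] complex_mod_cnj ..
  also have "(\<Sum>j=1..m. g j) = (\<Sum>j=1..m. 1 / (z j - of_real w)) + (\<Sum>j=1..m. g j - 1 / (z j - of_real w))"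
    by (simp add: sum_subtractf)
  also have "cmod \<dots> \<le> 5 / a + (\<Sum>j=1..m. 86 / a\<^sup>2 * (1 - cmod (z j)))"
    by (intro norm_triangle_mono cmod_sum_inverse_zeros_minus_w_le sum_norm_le g)
  also have "\<dots> \<le> 5 / a + 86 / a\<^sup>2 * (a ^ 3 * (1 - a) / 1600 * m + 1)"
    unfolding sum_distrib_left[symmetric]
    by (intro add_left_mono mult_left_mono sum_one_minus_cmod_zeros_le) simp
  finally show ?thesis .
qed

text \<open>With \<open>u = 1 / w\<close> each term is \<open>u^2 / (u - s) - u\<close>. Both sums
  have \<open>m\<close> terms, so the constants cancel and \<open>log_derivative_diff_le\<close> at
  \<open>u\<close> applies.\<close>

lemma cmod_sum_moebius_diff_le:
  "cmod ((\<Sum>i<m. \<zeta> i / (1 - of_real w * \<zeta> i)) - (\<Sum>j=1..m. z j / (1 - of_real w * z j))) \<le> 16 / a"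
proof -
  define u where "u = 1 / w"
  \<comment> \<open>All \<open>m + 1\<close> zeros must form one product, so \<open>a\<close> gets
    index 0; its term, at most \<open>1 / (u - 1)\<close>, is split off again below.\<close>
  define r where "r j = (if j = 0 then complex_of_real a else z j)" for j
  have w: "0 < w" using w_bounds a_pos by simp
  have u: "2 \<le> u" "u \<le> 2 / a" using w_bounds w a_pos by (auto simp: u_def field_simps)
  have cu: "cmod (of_real u) = u" using u by simp
  have r: "cmod (r j) \<le> 1" if "j \<in> {0..m}" for j
    using that zeros[of j] a_pos a_less_1 by (auto simp: r_def)
  have split: "{0..m} = insert 0 {1..m}" by auto
  have "(\<Prod>j\<in>{0..m}. (x - r j)) = (x - of_real a) * (\<Prod>j=1..m. (x - z j))" for x
    unfolding split by (subst prod.insert) (auto simp: r_def intro!: prod.cong)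
  then have "cmod ((\<Sum>i<m. 1 / (of_real u - \<zeta> i)) - (\<Sum>j\<in>{0..m}. 1 / (of_real u - r j)))
      \<le> (cmod (of_real u) + 1) / (cmod (of_real u) - 1)\<^sup>2"
    using r crit deriv u
    by (intro log_derivative_diff_le[where c = "of_nat (Suc m)"]) auto
  also have "(\<Sum>j\<in>{0..m}. 1 / (of_real u - r j)) = 1 / (of_real u - of_real a) + (\<Sum>j=1..m. 1 / (of_real u - z j))"
    unfolding split by (subst sum.insert) (auto simp: r_def intro!: sum.cong)
  finally have 1: "cmod ((\<Sum>i<m. 1 / (of_real u - \<zeta> i)) - (\<Sum>j=1..m. 1 / (of_real u - z j)) - 1 / (of_real u - of_real a))
      \<le> (u + 1) / (u - 1)\<^sup>2" unfolding cu by (simp add: algebra_simps)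
  have "cmod (1 / (complex_of_real u - of_real a)) \<le> 1 / (u - 1)"
    using u a_less_1 by (simp add: norm_divide frac_le flip: of_real_diff)
  with 1 have "cmod ((\<Sum>i<m. 1 / (of_real u - \<zeta> i)) - (\<Sum>j=1..m. 1 / (of_real u - z j)))
      \<le> (u + 1) / (u - 1)\<^sup>2 + 1 / (u - 1)"
    using norm_triangle_sub[of "(\<Sum>i<m. 1 / (of_real u - \<zeta> i)) - (\<Sum>j=1..m. 1 / (of_real u - z j))" "1 / (of_real u - of_real a)"]
    by linarith
  then have 2: "u\<^sup>2 * cmod ((\<Sum>i<m. 1 / (of_real u - \<zeta> i)) - (\<Sum>j=1..m. 1 / (of_real u - z j)))
      \<le> u\<^sup>2 * ((u + 1) / (u - 1)\<^sup>2 + 1 / (u - 1))" by (intro mult_left_mono) auto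
  have "u\<^sup>2 * ((u + 1) / (u - 1)\<^sup>2 + 1 / (u - 1)) \<le> 8 * u"
  proof -
    have "8 * u * (u - 1)\<^sup>2 - 2 * u ^ 3 = 2 * u * (u - 2) * (3 * u - 2)" by algebra
    moreover have "0 \<le> 2 * u * (u - 2) * (3 * u - 2)" using u by (intro mult_nonneg_nonneg) auto
    ultimately have "2 * u ^ 3 \<le> 8 * u * (u - 1)\<^sup>2" by linarith
    moreover have "u\<^sup>2 * ((u + 1) / (u - 1)\<^sup>2 + 1 / (u - 1)) = 2 * u ^ 3 / (u - 1)\<^sup>2"
      using u by (simp add: divide_simps) algebra
    ultimately show ?thesis using u by (simp add: pos_divide_le_eq)
  qed
  also have "\<dots> \<le> 16 / a" using u by simp
  finally have 3: "u\<^sup>2 * cmod ((\<Sum>i<m. 1 / (of_real u - \<zeta> i)) - (\<Sum>j=1..m. 1 / (of_real u - z j))) \<le> 16 / a"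
    using 2 by linarith
  have g: "s / (1 - of_real w * s) = of_real (u\<^sup>2) * (1 / (of_real u - s)) - of_real u" if "cmod s \<le> 1" for s
  proof -
    have "of_real u - s \<noteq> 0" using that u cu by auto
    moreover have eq: "1 - of_real w * s = (of_real u - s) / of_real u"
      using w by (simp add: u_def right_diff_distrib mult.commute)
    moreover have "complex_of_real u \<noteq> 0" using u by simp
    ultimately show ?thesis unfolding eq by (simp add: divide_simps) (simp add: algebra_simps power2_eq_square)
  qed
  have "(\<Sum>i<m. \<zeta> i / (1 - of_real w * \<zeta> i)) = of_real (u\<^sup>2) * (\<Sum>i<m. 1 / (of_real u - \<zeta> i)) - of_nat m * of_real u"
    using g[OF crit] by (simp add: sum_subtractf sum_distrib_left)
  moreover have "(\<Sum>j=1..m. z j / (1 - of_real w * z j)) = of_real (u\<^sup>2) * (\<Sum>j=1..m. 1 / (of_real u - z j)) - of_nat m * of_real u"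
    using g[OF zeros] by (simp add: sum_subtractf sum_distrib_left)
  ultimately have "(\<Sum>i<m. \<zeta> i / (1 - of_real w * \<zeta> i)) - (\<Sum>j=1..m. z j / (1 - of_real w * z j))
      = of_real (u\<^sup>2) * ((\<Sum>i<m. 1 / (of_real u - \<zeta> i)) - (\<Sum>j=1..m. 1 / (of_real u - z j)))"
    by (simp only: right_diff_distrib) simp
  then have "cmod ((\<Sum>i<m. \<zeta> i / (1 - of_real w * \<zeta> i)) - (\<Sum>j=1..m. z j / (1 - of_real w * z j)))
      = u\<^sup>2 * cmod ((\<Sum>i<m. 1 / (of_real u - \<zeta> i)) - (\<Sum>j=1..m. 1 / (of_real u - z j)))"
    by (simp add: norm_mult norm_power)
  then show ?thesis using 3 by simp
qed

lemma no_far_critical_points: False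
proof -
  define Z where "Z = (\<Sum>i<m. \<zeta> i / (1 - of_real w * \<zeta> i))"
  define y where "y = a * (1 - a) * m"
  have "Re Z \<le> (\<Sum>i<m. - (a * (1 - a) / 9))"
    unfolding Z_def Re_sum
    by (intro sum_mono lune_Re_moebius_le[OF a_pos a_less_1 w_def] crit far) auto
  then have "y / 9 \<le> cmod Z" using abs_Re_le_cmod[of Z] by (simp add: y_def mult_ac)
  also have "\<dots> \<le> 16 / a + (5 / a + 86 / a\<^sup>2 * (a ^ 3 * (1 - a) / 1600 * m + 1))"
    using norm_triangle_sub[of Z "\<Sum>j=1..m. z j / (1 - of_real w * z j)"]
      cmod_sum_moebius_diff_le cmod_sum_moebius_zeros_le unfolding Z_def by linarith
  finally have "a\<^sup>2 * (y / 9) \<le> a\<^sup>2 * (16 / a + (5 / a + 86 / a\<^sup>2 * (a ^ 3 * (1 - a) / 1600 * m + 1)))"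
    by (intro mult_left_mono) auto
  \<comment> \<open>Because \<open>86 / 1600 < 1 / 9\<close>, the term in
    \<open>a\<^sup>2 * y\<close> can be absorbed on the left, leaving a constant bound that
    contradicts \<open>m_ge\<close>.\<close>
  also have "\<dots> = 21 * a + 86 / 1600 * (a\<^sup>2 * y) + 86"
    using a_pos by (simp add: y_def field_simps power2_eq_square power3_eq_cube)
  finally have "a\<^sup>2 * y \<le> 2000" using a_less_1 by simp
  moreover have "a\<^sup>2 * y = a ^ 3 * (1 - a) * m" unfolding y_def by algebra
  ultimately show False using m_ge by simp
qed

end

section \<open>From the polynomial to the locale\<close>

theorem mainTheorem1:
  fixes a :: real and n :: nat and z :: "nat \<Rightarrow> complex" and P :: "complex poly"
  assumes "0 < a" and "a < 1"
    and "real n \<ge> sendov_N a"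
    and "\<And>j. j \<in> {1..n-1} \<Longrightarrow> cmod (z j) \<le> 1"
    and "P = [:- complex_of_real a, 1:] * (\<Prod>j\<in>{1..n-1}. [:- z j, 1:])"
  shows "\<exists>w. cmod (w - complex_of_real a) \<le> 1 \<and> poly (pderiv P) w = 0"
proof (rule ccontr)
  assume no: "\<not> ?thesis"
  define m where "m = n - 1"
  define r where "r j = (if j = 0 then complex_of_real a else z j)" for j
  have pos: "0 < a ^ 7 * (1 - a) ^ 4" using assms(1,2) by simp
  have le1: "a ^ 7 * (1 - a) ^ 4 \<le> 1 * 1" using assms(1,2) by (intro mult_mono power_le_one) auto
  have N: "20800 \<le> a ^ 7 * (1 - a) ^ 4 * n"
    using assms(3) pos by (simp add: sendov_N_def field_simps)
  then have "n \<noteq> 0" by (intro notI) simp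
  then have n: "n = Suc m" by (simp add: m_def)
  \<comment> \<open>Passing from \<open>n\<close> to \<open>m = n - 1\<close> loses at most 1, well
    within the slack of 800.\<close>
  have large: "20000 \<le> a ^ 7 * (1 - a) ^ 4 * m" using N le1 by (simp add: n algebra_simps)
  have split: "{0..m} = insert 0 {1..m}" by auto
  have P: "P = (\<Prod>j\<in>{0..m}. [:- r j, 1:])"
    unfolding assms(5) m_def[symmetric] split
    by (subst prod.insert) (auto simp: r_def intro!: prod.cong)
  have poly_P: "poly P x = (\<Prod>j\<in>{0..m}. (x - r j))" for x
    by (simp add: P poly_prod)
  have poly_P': "poly P x = (x - of_real a) * (\<Prod>j=1..m. (x - z j))" for x
    by (simp add: assms(5) m_def poly_prod algebra_simps)
  have deg: "degree P = Suc m" unfolding P by (subst degree_prod_eq_sum_degree) auto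
  have lead: "lead_coeff P = 1" unfolding P by (simp add: lead_coeff_prod)
  have deg': "degree (pderiv P) = m" by (simp add: degree_pderiv deg)
  have lead': "lead_coeff (pderiv P) = of_nat (Suc m)"
    using lead by (simp add: deg deg' coeff_pderiv)
  \<comment> \<open>The fundamental theorem of algebra lists the critical points with
    multiplicity.\<close>
  obtain \<zeta> where \<zeta>: "smult (lead_coeff (pderiv P)) (\<Prod>i<degree (pderiv P). [:- \<zeta> i, 1:]) = pderiv P"
    by (rule complex_poly_decompose')
  have pd: "poly (pderiv P) x = of_nat (Suc m) * (\<Prod>i<m. (x - \<zeta> i))" for x
    by (subst \<zeta>[symmetric]) (simp add: poly_prod deg' lead'[unfolded deg'] del: of_nat_Suc)
  have root: "poly (pderiv P) (\<zeta> i) = 0" if "i < m" for i using that by (auto simp: pd)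
  have der: "((\<lambda>x. poly P x) has_field_derivative poly (pderiv P) x) (at x)" for x by (rule poly_DERIV)
  have "far_critical_points a m z \<zeta>"
  proof
    fix i assume i: "i < m"
    show "cmod (\<zeta> i) \<le> 1"
    proof (rule Gauss_Lucas_unit_disk[of "{0..m}" r])
      show "cmod (r j) \<le> 1" if "j \<in> {0..m}" for j
        using that assms(1,2) assms(4)[of j] by (auto simp: r_def m_def)
      show "((\<lambda>x. \<Prod>j\<in>{0..m}. (x - r j)) has_field_derivative 0) (at (\<zeta> i))"
        using der[of "\<zeta> i"] unfolding root[OF i] poly_P .
    qed auto
    show "1 \<le> cmod (of_real a - \<zeta> i)"
      using no root[OF i] by (metis linorder_le_cases norm_minus_commute)
  next
    show "((\<lambda>x. (x - of_real a) * (\<Prod>j=1..m. (x - z j))) has_field_derivative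
             of_nat (Suc m) * (\<Prod>i<m. (x - \<zeta> i))) (at x)" for x
      using der[of x] unfolding poly_P' pd .
  qed (use assms(1,2) assms(4)[folded m_def] large in auto)
  then show False by (rule far_critical_points.no_far_critical_points)
qed

end
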